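(* Let $X\subset\mathbb{CP}^4$ be a quintic 3-fold with genus 0 Gopakumar--Vafa invariants $\mathrm{GV}_d$ $(d\ge1)$, and set $$c_{ttt}(Q,q)=5+\sum_{d,r\ge1}d^2\,\frac{1-q^{dr}}{1-q^r}\,\mathrm{GV}_d\,Q^{dr}\in\mathbb Z[q][[Q]],\qquad c_{ttt}(Q)=5+\sum_{d=1}^\infty d^3\,\mathrm{GV}_d\,\mathrm{Li}_0(Q^d).$$ Let $D(Q,q,0)$ be the $4\times4$ matrix $$D(Q,q,0)=\begin{pmatrix}0&1&[a-c-Ea]&[b-e+Ea-Eb]\\0&0&1+[c-Ec]&[e+Ec-Ee]\\0&0&0&1\\0&0&0&0\end{pmatrix}$$ with $(i,j)$-entries $D_{i,j}(Q,q,0)$. Then $c_{ttt}(Q,q)$ is a $q$-deformation of the Yukawa coupling $c_{ttt}(Q)$; indeed $$c_{ttt}(Q,1)=c_{ttt}(Q),\qquad 5D_{2,3}(Q,q,0)=c_{ttt}(Q,q).$$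
   Context: $\mathrm{Li}_0(z)=\sum_{n\ge1}z^n$. The Gopakumar--Vafa invariants are $\mathrm{GV}_n=\sum_{d|n}\frac{\mu(d)}{d^3}\mathrm{GW}_{n/d}$, with $\mathrm{GW}_n$ the genus 0 degree $n$ Gromov--Witten invariants of the quintic; they are known to be integers. The expression $\frac{1-q^{dr}}{1-q^r}$ denotes the polynomial $\sum_{j=0}^{d-1}q^{rj}$, and $c_{ttt}(Q,1)$ is obtained by setting $q=1$ coefficientwise in $Q$. The series $c_{ttt}(Q)$ is the Yukawa coupling (3-point function) of the quintic, i.e. $(Q\,\partial/\partial Q)^3$ of $\frac56(\log Q)^3+\sum_{d\ge1}\mathrm{GV}_d\,\mathrm{Li}_3(Q^d)$, where $\mathrm{Li}_3(z)=\sum_{n\ge1}z^n/n^3$. For a function $f=f(d,r,q)\in\mathbb Q(q)$ (for each pair of integers $d,r\ge1$) put $$[f]=\sum_{d,r\ge1}f(d,r,q^r)\,\mathrm{GV}_d\,Q^{dr},\qquad (Ef)(d,r,q)=q^df(d,r,q).$$ The functions $a,b,c,e$ are defined by $$5a(d,r,q)=\frac{dr}{1-q}+\frac{dq}{(1-q)^2},\qquad 5b(d,r,q)=\frac{rd+r^2-d}{1-q}+\frac{d}{(1-q)^2}-\frac{q+q^2}{(1-q)^3},$$ $$5c(d,r,q)=\frac{d^2}{1-q},\qquad 5e(d,r,q)=\frac{dr}{1-q}-\frac{d(dq+q-d)}{(1-q)^2}.$$ (According to the paper, conditionally on its conjectural formula for the small $J$-function, $I-D^{\rm T}$ is the matrix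 of the small linear $q$-difference equation of the quantum K-theory of the quintic.) *)

theory Defs
  imports
    "HOL-Analysis.Analysis"
    "HOL-Computational_Algebra.Computational_Algebra"
    "HOL-Library.Function_Algebras"
begin

text \<open>Infinite sums of formal power series are \<^const>\<open>infsum\<close> with respect to the metric on
  \<^typ>\<open>'a fps\<close>, i.e. unconditional sums for the adic topology given by the variable \<open>Q\<close>,
  which is \<^const>\<open>fps_X\<close> throughout.\<close>

definition moebius_mu :: "nat \<Rightarrow> int" where
  "moebius_mu n = (if squarefree n then (- 1) ^ card (prime_factors n) else 0)"

definition gopakumar_vafa :: "(nat \<Rightarrow> rat) \<Rightarrow> nat \<Rightarrow> rat" where
  "gopakumar_vafa GW n =
     (\<Sum>d | d dvd n. of_int (moebius_mu d) / of_nat d ^ 3 * GW (n div d))"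

definition fps_map :: "('a \<Rightarrow> 'b) \<Rightarrow> 'a fps \<Rightarrow> 'b fps" where
  "fps_map h F = Abs_fps (\<lambda>n. h (F $ n))"


subsection \<open>The Yukawa coupling\<close>

definition Li :: "nat \<Rightarrow> rat fps" where
  "Li s = Abs_fps (\<lambda>n. if n = 0 then 0 else 1 / of_nat n ^ s)"

text \<open>\<open>\<rat>[[Q]][log Q]\<close> is represented by polynomials over \<^typ>\<open>rat fps\<close>, the polynomial variable
  standing for \<open>log Q\<close>. The derivation \<open>Q \<partial>/\<partial>Q\<close> maps \<open>log Q\<close> to 1, whence the summand
  \<^const>\<open>pderiv\<close>.\<close>

definition Q_deriv :: "rat fps poly \<Rightarrow> rat fps poly" where
  "Q_deriv p = map_poly (\<lambda>f. fps_X * fps_deriv f) p + pderiv p"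

definition prepotential :: "(nat \<Rightarrow> int) \<Rightarrow> rat fps poly" where
  "prepotential GV = monom (fps_const (5 / 6)) 3
     + [: \<Sum>\<^sub>\<infinity>d\<in>{1..}. fps_const (of_int (GV d)) * fps_compose (Li 3) (fps_X ^ d) :]"

definition yukawa :: "(nat \<Rightarrow> int) \<Rightarrow> rat fps poly" where
  "yukawa GV = (Q_deriv ^^ 3) (prepotential GV)"

definition c_ttt :: "(nat \<Rightarrow> int) \<Rightarrow> rat fps" where
  "c_ttt GV = 5 +
     (\<Sum>\<^sub>\<infinity>d\<in>{1..}. fps_const (of_nat d ^ 3 * of_int (GV d)) * fps_compose (Li 0) (fps_X ^ d))"


subsection \<open>The series with coefficients in \<open>\<int>[q]\<close>\<close>

text \<open>The polynomial denoted by \<open>(1 - q\<^sup>d\<^sup>r) / (1 - q\<^sup>r)\<close>.\<close>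

definition q_quotient :: "nat \<Rightarrow> nat \<Rightarrow> int poly" where
  "q_quotient d r = (\<Sum>j<d. monom 1 (r * j))"

definition c_ttt_q :: "(nat \<Rightarrow> int) \<Rightarrow> int poly fps" where
  "c_ttt_q GV = 5 +
     (\<Sum>\<^sub>\<infinity>(d, r)\<in>{1..} \<times> {1..}.
        fps_const (of_nat d ^ 2 * q_quotient d r * of_int (GV d)) * fps_X ^ (d * r))"


subsection \<open>The matrix \<open>D(Q, q, 0)\<close>\<close>

text \<open>The field \<open>\<rat>(q)\<close>, as the fraction field of \<open>\<int>[q]\<close>; \<^const>\<open>to_fract\<close> is the
  inclusion of \<open>\<int>[q]\<close>.\<close>

type_synonym ratfun = "int poly fract"

definition q :: ratfun where
  "q = to_fract (monom 1 1)"

text \<open>\<open>f(q) \<mapsto> f(q\<^sup>r)\<close>; only meaningful for \<open>r \<ge> 1\<close>, when the denominator stays nonzero.\<close>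

definition q_power_subst :: "nat \<Rightarrow> ratfun \<Rightarrow> ratfun" where
  "q_power_subst r f = (case quot_of_fract f of (u, v) \<Rightarrow>
     to_fract (pcompose u (monom 1 r)) / to_fract (pcompose v (monom 1 r)))"

definition bracket :: "(nat \<Rightarrow> int) \<Rightarrow> (nat \<Rightarrow> nat \<Rightarrow> ratfun) \<Rightarrow> ratfun fps" where
  "bracket GV f = (\<Sum>\<^sub>\<infinity>(d, r)\<in>{1..} \<times> {1..}.
     fps_const (q_power_subst r (f d r) * of_int (GV d)) * fps_X ^ (d * r))"

definition E_op :: "(nat \<Rightarrow> nat \<Rightarrow> ratfun) \<Rightarrow> nat \<Rightarrow> nat \<Rightarrow> ratfun" where
  "E_op f d r = q ^ d * f d r"

definition a_fun :: "nat \<Rightarrow> nat \<Rightarrow> ratfun" where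
  "a_fun d r = (of_nat d * of_nat r / (1 - q) + of_nat d * q / (1 - q) ^ 2) / 5"

definition b_fun :: "nat \<Rightarrow> nat \<Rightarrow> ratfun" where
  "b_fun d r = ((of_nat r * of_nat d + of_nat r ^ 2 - of_nat d) / (1 - q)
     + of_nat d / (1 - q) ^ 2 - (q + q ^ 2) / (1 - q) ^ 3) / 5"

definition c_fun :: "nat \<Rightarrow> nat \<Rightarrow> ratfun" where
  "c_fun d r = (of_nat d ^ 2 / (1 - q)) / 5"

definition e_fun :: "nat \<Rightarrow> nat \<Rightarrow> ratfun" where
  "e_fun d r = (of_nat d * of_nat r / (1 - q)
     - of_nat d * (of_nat d * q + q - of_nat d) / (1 - q) ^ 2) / 5"

text \<open>Indices of \<^typ>\<open>4\<close> start at 1, so \<open>D_matrix GV $ i $ j\<close> is the \<open>(i, j)\<close>-entry in the usual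
  numbering.\<close>

definition D_matrix :: "(nat \<Rightarrow> int) \<Rightarrow> ratfun fps ^ 4 ^ 4" where
  "D_matrix GV = vector
     [vector [0, 1, bracket GV (a_fun - c_fun - E_op a_fun),
                    bracket GV (b_fun - e_fun + E_op a_fun - E_op b_fun)],
      vector [0, 0, 1 + bracket GV (c_fun - E_op c_fun),
                    bracket GV (e_fun + E_op c_fun - E_op e_fun)],
      vector [0, 0, 0, 1],
      vector [0, 0, 0, 0]]"

end

theory Submission
  imports Defs
begin

text \<open>
  All three identities compare coefficients of \<open>Q\<^sup>n\<close>. Every infinite sum involved is locally finite:
  a pair \<open>(d, r)\<close> contributes to the power \<open>Q\<^sup>d\<^sup>r\<close> only, so that \<open>Q\<^sup>n\<close> collects the divisors
  \<open>d\<close> of \<open>n\<close>, with \<open>r = n / d\<close>. A series of the form \<open>\<Sum>\<^sub>d g\<^sub>d F(Q\<^sup>d)\<close> has the same shape, the sum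
  over \<open>r\<close> being hidden in \<open>F\<close>. Once each series is written as such a generalised Lambert series
  (\<open>infsum_pairs_eq_lambert\<close>, \<open>infsum_compose_eq_lambert\<close>), each identity reduces to one about
  a single term \<open>(d, r)\<close>:

  \<^item> \<open>(Q \<partial>/\<partial>Q)\<^sup>3\<close> multiplies the coefficient of \<open>Q\<^sup>d\<^sup>r\<close> by \<open>d\<^sup>3 r\<^sup>3\<close>, which turns the coefficient
    \<open>1 / r\<^sup>3\<close> of \<open>Li\<^sub>3\<close> into the coefficient \<open>1\<close> of \<open>Li\<^sub>0\<close>, while the cubic term in \<open>log Q\<close>
    differentiates to the constant \<open>5\<close>;

  \<^item> at \<open>q = 1\<close> the polynomial \<open>\<Sum>\<^sub>j\<^sub><\<^sub>d q\<^sup>r\<^sup>j\<close> becomes \<open>d\<close>, so \<open>d\<^sup>2\<close> becomes \<open>d\<^sup>3\<close>;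

  \<^item> \<open>5 (c - E c) = d\<^sup>2 (1 - q\<^sup>d) / (1 - q)\<close> is \<open>d\<^sup>2\<close> times a geometric sum in \<open>q\<close>, and replacing
    \<open>q\<close> by \<open>q\<^sup>r\<close> yields \<open>d\<^sup>2 \<Sum>\<^sub>j\<^sub><\<^sub>d q\<^sup>r\<^sup>j\<close>.
\<close>

(* Until the matrix appears, the infix $ means only a coefficient of a power series. *)
unbundle no vec_syntax

section \<open>Locally finite sums of formal power series\<close>

text \<open>Convergence in the adic topology means that each coefficient is eventually constant along the
  finite partial sums; here the coefficient of index \<open>n\<close> stabilises as soon as \<open>B n\<close> is included.\<close>

lemma has_sum_fpsI:
  fixes f :: "'i \<Rightarrow> 'a::ab_group_add fps"
  assumes fin: "\<And>n. finite (B n)" and sub: "\<And>n. B n \<subseteq> A"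
    and zero: "\<And>n i. i \<in> A - B n \<Longrightarrow> f i $ n = 0"
  shows "(f has_sum Abs_fps (\<lambda>n. \<Sum>i\<in>B n. f i $ n)) A"
  unfolding has_sum_def
proof (rule tendsto_fpsI)
  fix n
  show "\<forall>\<^sub>F S in finite_subsets_at_top A. sum f S $ n = Abs_fps (\<lambda>n. \<Sum>i\<in>B n. f i $ n) $ n"
    unfolding eventually_finite_subsets_at_top
  proof (intro exI[of _ "B n"] conjI allI impI)
    fix S assume S: "finite S \<and> B n \<subseteq> S \<and> S \<subseteq> A"
    have "(\<Sum>i\<in>S. f i $ n) = (\<Sum>i\<in>B n. f i $ n)"
      using S zero by (intro sum.mono_neutral_right) auto
    then show "sum f S $ n = Abs_fps (\<lambda>n. \<Sum>i\<in>B n. f i $ n) $ n"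
      by (simp add: fps_sum_nth)
  qed (use fin sub in auto)
qed

text \<open>This is \<open>\<Sum>\<^sub>d\<^sub>,\<^sub>r g d r Q\<^sup>d\<^sup>r\<close> over \<open>d, r \<ge> 1\<close>, given by its coefficients so that no limit
  is involved. For \<open>g d r = a d\<close> this is the classical Lambert series \<open>\<Sum>\<^sub>d a\<^sub>d Q\<^sup>d / (1 - Q\<^sup>d)\<close>.\<close>

definition lambert_fps :: "(nat \<Rightarrow> nat \<Rightarrow> 'a::comm_monoid_add) \<Rightarrow> 'a fps" where
  "lambert_fps g = Abs_fps (\<lambda>n. if n = 0 then 0 else \<Sum>d | d dvd n. g d (n div d))"

lemma lambert_fps_cong:
  assumes "\<And>d r. d \<ge> 1 \<Longrightarrow> r \<ge> 1 \<Longrightarrow> g d r = h d r"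
  shows "lambert_fps g = lambert_fps h"
proof -
  have "(\<Sum>d | d dvd n. g d (n div d)) = (\<Sum>d | d dvd n. h d (n div d))" if "n > 0" for n
    using that assms by (intro sum.cong) (auto elim!: dvdE)
  then show ?thesis
    by (simp add: lambert_fps_def fps_eq_iff)
qed

lemma fps_map_lambert:
  assumes "h 0 = 0" "\<And>x y. h (x + y) = h x + h y"
  shows "fps_map h (lambert_fps g) = lambert_fps (\<lambda>d r. h (g d r))"
proof -
  have "h (sum f S) = (\<Sum>i\<in>S. h (f i))" for f and S :: "nat set"
    by (induction S rule: infinite_finite_induct) (simp_all add: assms)
  then show ?thesis
    by (simp add: fps_map_def lambert_fps_def fps_eq_iff assms)
qed

text \<open>The coefficient of \<open>Q\<^sup>n\<close> sees only the pairs with \<open>d r = n\<close>, and for \<open>n > 0\<close> these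
  correspond to the divisors \<open>d\<close> of \<open>n\<close>; since \<open>d, r \<ge> 1\<close>, there are none for \<open>n = 0\<close>.\<close>

lemma infsum_pairs_eq_lambert:
  fixes g :: "nat \<Rightarrow> nat \<Rightarrow> 'a::comm_ring_1"
  shows "(\<Sum>\<^sub>\<infinity>(d, r)\<in>{1..} \<times> {1..}. fps_const (g d r) * fps_X ^ (d * r)) = lambert_fps g"
proof -
  define f where "f = (\<lambda>(d, r). fps_const (g d r) * fps_X ^ (d * r))"
  define B where "B n = (if n = 0 then {} else (\<lambda>d. (d, n div d)) ` {d. d dvd n})" for n :: nat
  have "(f has_sum Abs_fps (\<lambda>n. \<Sum>i\<in>B n. f i $ n)) ({1..} \<times> {1..})"
  proof (rule has_sum_fpsI)
    show "f i $ n = 0" if "i \<in> {1..} \<times> {1..} - B n" for i n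
      using that by (auto simp: f_def B_def image_iff split: if_splits)
    show "B n \<subseteq> {1..} \<times> {1..}" for n
      by (auto simp: B_def Suc_le_eq elim!: dvdE)
  qed (simp add: B_def)
  also have "Abs_fps (\<lambda>n. \<Sum>i\<in>B n. f i $ n) = lambert_fps g"
  proof (rule fps_ext)
    fix n :: nat
    have "inj_on (\<lambda>d. (d, n div d)) {d. d dvd n}"
      by (auto intro: inj_onI)
    then show "Abs_fps (\<lambda>n. \<Sum>i\<in>B n. f i $ n) $ n = lambert_fps g $ n"
      by (auto simp: B_def lambert_fps_def f_def sum.reindex intro!: sum.cong)
  qed
  finally show ?thesis
    unfolding f_def by (rule infsumI)
qed

text \<open>Since \<open>F(Q\<^sup>d) = \<Sum>\<^sub>r F\<^sub>r Q\<^sup>d\<^sup>r\<close>, this is the double sum again with its inner sum carried out.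
  A nonzero \<open>F\<^sub>0\<close> would let every \<open>d\<close> contribute to the constant coefficient, and the sum could
  diverge.\<close>

lemma infsum_compose_eq_lambert:
  fixes g :: "nat \<Rightarrow> 'a::comm_ring_1" and F :: "'a fps"
  assumes "F $ 0 = 0"
  shows "(\<Sum>\<^sub>\<infinity>d\<in>{1..}. fps_const (g d) * fps_compose F (fps_X ^ d))
       = lambert_fps (\<lambda>d r. g d * F $ r)"
proof -
  define f where "f = (\<lambda>d. fps_const (g d) * fps_compose F (fps_X ^ d))"
  define B where "B n = (if n = 0 then {} else {d. d dvd n})" for n :: nat
  have f_nth: "f d $ n = (if d dvd n then g d * F $ (n div d) else 0)" for d n
    by (simp add: f_def fps_nth_compose_X_power)
  have "(f has_sum Abs_fps (\<lambda>n. \<Sum>i\<in>B n. f i $ n)) {1..}"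
  proof (rule has_sum_fpsI)
    show "f i $ n = 0" if "i \<in> {1..} - B n" for i n
      using that assms by (auto simp: f_nth B_def split: if_splits)
    show "B n \<subseteq> {1..}" for n
      by (auto simp: B_def Suc_le_eq elim!: dvdE)
  qed (simp add: B_def)
  also have "Abs_fps (\<lambda>n. \<Sum>i\<in>B n. f i $ n) = lambert_fps (\<lambda>d r. g d * F $ r)"
    by (rule fps_ext) (simp add: B_def lambert_fps_def f_nth)
  finally show ?thesis
    unfolding f_def by (rule infsumI)
qed

section \<open>The Yukawa coupling\<close>

lemma c_ttt_eq_lambert: "c_ttt GV = 5 + lambert_fps (\<lambda>d r. of_nat d ^ 3 * of_int (GV d))"
proof -
  have "c_ttt GV = 5 + lambert_fps (\<lambda>d r. of_nat d ^ 3 * of_int (GV d) * Li 0 $ r)"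
    unfolding c_ttt_def by (subst infsum_compose_eq_lambert) (simp_all add: Li_def)
  also have "\<dots> = 5 + lambert_fps (\<lambda>d r. of_nat d ^ 3 * of_int (GV d))"
    by (intro arg_cong[where f = "(+) 5"] lambert_fps_cong) (simp add: Li_def)
  finally show ?thesis .
qed

text \<open>The operator \<open>Q \<partial>/\<partial>Q\<close> has the monomials \<open>Q\<^sup>d\<^sup>r\<close> as eigenvectors, with eigenvalues \<open>d r\<close>.\<close>

lemma euler_deriv_lambert:
  "fps_X * fps_deriv (lambert_fps g) = lambert_fps (\<lambda>d r. of_nat d * of_nat r * (g d r :: rat))"
proof (rule fps_ext)
  fix n
  have "of_nat n * (\<Sum>d | d dvd n. g d (n div d))
      = (\<Sum>d | d dvd n. of_nat d * of_nat (n div d) * g d (n div d))"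
    unfolding sum_distrib_left
    by (intro sum.cong) (auto simp flip: of_nat_mult)
  then show "(fps_X * fps_deriv (lambert_fps g)) $ n
      = lambert_fps (\<lambda>d r. of_nat d * of_nat r * g d r) $ n"
    by (simp add: lambert_fps_def)
qed

text \<open>The part free of \<open>log Q\<close> and the cubic part \<open>5/6 (log Q)\<^sup>3\<close> do not interact: on the former the
  derivation is \<open>Q \<partial>/\<partial>Q\<close>, and the latter has a constant coefficient, so that only the derivative
  with respect to \<open>log Q\<close> acts on it and gives \<open>5/6 \<cdot> 3! = 5\<close> after three steps.\<close>

lemma yukawa_eq_c_ttt: "yukawa GV = [: c_ttt GV :]"
proof -
  define \<theta> :: "rat fps \<Rightarrow> rat fps" where "\<theta> f = fps_X * fps_deriv f" for f
  define L where "L = lambert_fps (\<lambda>d r. of_int (GV d) * Li 3 $ r)"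
  have \<theta>_const: "\<theta> (fps_const a) = 0" for a
    by (simp add: \<theta>_def)
  have Q_deriv: "Q_deriv p = map_poly \<theta> p + pderiv p" for p
    unfolding Q_deriv_def \<theta>_def ..
  have \<theta>_0: "\<theta> 0 = 0"
    by (simp add: \<theta>_def)
  have \<theta>_add: "\<theta> (f + g) = \<theta> f + \<theta> g" for f g
    by (simp add: \<theta>_def algebra_simps)
  have prepotential: "prepotential GV = [: L, 0, 0, fps_const (5 / 6) :]"
    unfolding prepotential_def L_def
    by (subst infsum_compose_eq_lambert) (simp_all add: Li_def monom_altdef numeral_3_eq_3)
  have "yukawa GV = [: \<theta> (\<theta> (\<theta> L)) + 5 :]"
    unfolding yukawa_def prepotential
    by (simp add: numeral_3_eq_3 Q_deriv map_poly_pCons \<theta>_0 \<theta>_add \<theta>_const pderiv_pCons)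
  also have "\<theta> (\<theta> (\<theta> L)) = lambert_fps (\<lambda>d r. of_nat d ^ 3 * of_int (GV d))"
    unfolding \<theta>_def L_def euler_deriv_lambert
    by (intro lambert_fps_cong) (simp add: Li_def field_simps power3_eq_cube)
  finally show ?thesis
    by (simp add: c_ttt_eq_lambert add.commute)
qed

section \<open>Specialisation at \<open>q = 1\<close>\<close>

lemma c_ttt_q_eq_lambert:
  "c_ttt_q GV = 5 + lambert_fps (\<lambda>d r. of_nat d ^ 2 * q_quotient d r * of_int (GV d))"
  unfolding c_ttt_q_def by (simp only: infsum_pairs_eq_lambert)

lemma fps_map_numeral_add:
  assumes "h 0 = 0" "\<And>x y. h (x + y) = h x + h y" "h (numeral k) = numeral k"
  shows "fps_map h (numeral k + F) = numeral k + fps_map h F"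
  by (simp add: fps_map_def fps_eq_iff assms fps_numeral_nth)

lemma c_ttt_q_at_1: "fps_map (\<lambda>p. of_int (poly p 1)) (c_ttt_q GV) = c_ttt GV"
proof -
  have "poly (q_quotient d r) 1 = int d" for d r
    by (simp add: q_quotient_def poly_sum poly_monom)
  then show ?thesis
    by (simp add: c_ttt_q_eq_lambert c_ttt_eq_lambert fps_map_numeral_add fps_map_lambert
        power2_eq_square power3_eq_cube)
qed

section \<open>The entry \<open>D\<^sub>2\<^sub>,\<^sub>3\<close>\<close>

text \<open>Replacing \<open>q\<close> by \<open>q\<^sup>r\<close> may be computed on any representation as a quotient, in lowest terms
  or not: composition with \<open>q\<^sup>r\<close> preserves the cross-multiplied equation of two representations,
  and for \<open>r \<ge> 1\<close> it sends no nonzero polynomial to zero.\<close>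

lemma q_power_subst_divide:
  assumes "r \<ge> 1" "v \<noteq> 0"
  shows "q_power_subst r (to_fract u / to_fract v)
       = to_fract (pcompose u (monom 1 r)) / to_fract (pcompose v (monom 1 r))"
proof -
  define f where "f = to_fract u / to_fract v"
  obtain x y where xy: "quot_of_fract f = (x, y)"
    by fastforce
  have y: "y \<noteq> 0"
    using snd_quot_of_fract_nonzero[of f] xy by simp
  have "f = to_fract x / to_fract y"
    using quot_to_fract_quot_of_fract[of f] xy
    by (simp add: quot_to_fract_def Fract_conv_to_fract)
  then have "to_fract (x * v) = to_fract (u * y)"
    using y assms(2) by (simp add: f_def field_simps)
  then have "pcompose (x * v) (monom 1 r) = pcompose (u * y) (monom 1 r)"
    by (simp only: to_fract_eq_iff)
  then have eq: "to_fract (pcompose x (monom 1 r)) * to_fract (pcompose v (monom 1 r))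
      = to_fract (pcompose u (monom 1 r)) * to_fract (pcompose y (monom 1 r))"
    unfolding pcompose_mult by (simp flip: to_fract_mult)
  have "pcompose p (monom 1 r) \<noteq> 0" if "p \<noteq> 0" for p :: "int poly"
    using pcompose_eq_0[of p "monom 1 r"] that assms(1) by (auto simp: degree_monom_eq)
  then show ?thesis
    using eq y assms(2) unfolding f_def[symmetric]
    by (simp add: q_power_subst_def xy frac_eq_eq)
qed

lemma to_fract_of_nat: "to_fract (of_nat n) = of_nat n"
  by (induction n) simp_all

lemma to_fract_of_int: "to_fract (of_int k) = of_int k"
  by (cases k) (simp_all add: to_fract_of_nat)

lemma to_fract_numeral: "to_fract (numeral k) = numeral k"
  using to_fract_of_nat[of "numeral k"] by simp

lemma to_fract_power: "to_fract (x ^ n) = to_fract x ^ n"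
  by (induction n) simp_all

lemma pcompose_q_quotient: "pcompose (q_quotient d 1) (monom 1 r) = q_quotient d r"
  unfolding q_quotient_def pcompose_sum
  by (simp add: pcompose_altdef map_poly_monom poly_monom monom_power)

text \<open>Summing the geometric series leaves \<open>5\<close> as the only denominator, and \<open>5\<close> is unaffected by
  replacing \<open>q\<close> with \<open>q\<^sup>r\<close>; the substitution thereby becomes one in the polynomial numerator.\<close>

lemma c_minus_Ec:
  "c_fun d r - E_op c_fun d r = to_fract (of_nat d ^ 2 * q_quotient d 1) / to_fract 5"
proof -
  have q_ne_1: "q \<noteq> 1"
  proof
    assume "q = 1"
    then have "monom (1::int) 1 = monom 1 0"
      unfolding q_def by (metis monom_eq_1 to_fract_1 to_fract_eq_iff)
    then show False
      using degree_monom_eq[of "1::int" 1] by simp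
  qed
  have "to_fract (q_quotient d 1) = (\<Sum>j<d. q ^ j)"
    by (simp add: q_quotient_def q_def monom_power flip: to_fract_power)
  also have "\<dots> = (1 - q ^ d) / (1 - q)"
    using q_ne_1 by (simp add: sum_gp_strict)
  finally have geometric: "to_fract (q_quotient d 1) = (1 - q ^ d) / (1 - q)" .
  have "c_fun d r - E_op c_fun d r = of_nat d ^ 2 * ((1 - q ^ d) / (1 - q)) / 5"
    by (simp add: c_fun_def E_op_def diff_divide_distrib right_diff_distrib mult.commute)
  then show ?thesis
    by (simp only: geometric to_fract_mult to_fract_power to_fract_of_nat to_fract_numeral)
qed

lemma q_power_subst_c_minus_Ec:
  assumes "r \<ge> 1"
  shows "5 * q_power_subst r ((c_fun - E_op c_fun) d r) = to_fract (of_nat d ^ 2 * q_quotient d r)"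
proof -
  have const: "pcompose (of_nat k) p = of_nat k" for k and p :: "int poly"
    by (simp add: of_nat_poly)
  have "q_power_subst r ((c_fun - E_op c_fun) d r)
      = to_fract (of_nat d ^ 2 * q_quotient d r) / to_fract 5"
    using assms const[of 5] const[of "d ^ 2"]
    by (simp add: c_minus_Ec q_power_subst_divide pcompose_mult pcompose_q_quotient
        del: to_fract_mult One_nat_def)
  then show ?thesis
    by (simp add: to_fract_numeral)
qed

unbundle vec_syntax

lemma D_matrix_2_3: "D_matrix GV $ 2 $ 3 = 1 + bracket GV (c_fun - E_op c_fun)"
  by (simp add: D_matrix_def vector_def)

lemma numeral_mult_lambert:
  "numeral k * lambert_fps g = lambert_fps (\<lambda>d r. numeral k * (g d r :: 'a::comm_ring_1))"
  by (simp add: fps_eq_iff lambert_fps_def sum_distrib_left numeral_fps_const)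

lemma five_D_matrix_2_3: "5 * (D_matrix GV $ 2 $ 3) = fps_map to_fract (c_ttt_q GV)"
proof -
  have "5 * bracket GV (c_fun - E_op c_fun)
      = lambert_fps (\<lambda>d r. to_fract (of_nat d ^ 2 * q_quotient d r * of_int (GV d)))"
    unfolding bracket_def infsum_pairs_eq_lambert numeral_mult_lambert
  proof (rule lambert_fps_cong)
    fix d r :: nat assume "r \<ge> 1"
    then show "5 * (q_power_subst r ((c_fun - E_op c_fun) d r) * of_int (GV d))
        = to_fract (of_nat d ^ 2 * q_quotient d r * of_int (GV d))"
      using q_power_subst_c_minus_Ec[of r d] by (simp add: to_fract_of_int mult.assoc[symmetric])
  qed
  then show ?thesis
    by (simp add: D_matrix_2_3 distrib_left c_ttt_q_eq_lambert fps_map_numeral_add fps_map_lambert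
        to_fract_numeral)
qed

theorem corollary1p5:
  fixes GW :: "nat \<Rightarrow> rat" and GV :: "nat \<Rightarrow> int"
  assumes "\<And>n. n \<ge> 1 \<Longrightarrow> of_int (GV n) = gopakumar_vafa GW n"
  shows "yukawa GV = [: c_ttt GV :]
       \<and> fps_map (\<lambda>p. of_int (poly p 1)) (c_ttt_q GV) = c_ttt GV
       \<and> 5 * (D_matrix GV $ 2 $ 3) = fps_map to_fract (c_ttt_q GV)"
  using yukawa_eq_c_ttt c_ttt_q_at_1 five_D_matrix_2_3 by blast

end
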